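(* Let $(M^n,g)$ be a connected Riemannian manifold and let $E_1$ and $E_2$ be orthogonal complementary distributions on $M$ (so $TM=E_1\oplus E_2$ orthogonally) of dimensions $n_1$ and $n_2$ respectively. Let $\pi_i$ denote the orthogonal projection of $TM$ onto $E_i$, $i=1,2$. Then the trace-free symmetric tensor $K=n_2\pi_1-n_1\pi_2$ is Killing if and only if the following conditions hold: $$\nabla_{X_1}X_1\in\Gamma(E_1)\quad\forall\,X_1\in\Gamma(E_1)\qquad\text{and}\qquad\nabla_{X_2}X_2\in\Gamma(E_2)\quad\forall\,X_2\in\Gamma(E_2).$$
   Context: $\nabla$ is the Levi-Civita connection of $g$. Symmetric endomorphisms of $TM$ are identified with symmetric 2-tensors via $K(X,Y)=g(KX,Y)$. A symmetric 2-tensor $K$ is called Killing if the complete symmetrization of $\nabla K$ vanishes, equivalently $(\nabla_XK)(X,X)=0$ for all tangent vectors $X$. *)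

theory Defs
  imports "HOL-Analysis.Analysis" "HOL-Library.Function_Algebras"
begin

section \<open>Smooth functions on Euclidean spaces\<close>

text \<open>For open S, this is the usual class of k times continuously differentiable functions on S:
  f is differentiable and all its directional derivatives are of class k - 1. (For k \<ge> 1,
  continuity of the k-th order derivatives entails that of all lower ones.)\<close>

primrec C_k_on :: "nat \<Rightarrow> 'e::euclidean_space set \<Rightarrow> ('e \<Rightarrow> 'f::real_normed_vector) \<Rightarrow> bool" where
  "C_k_on 0 S f \<longleftrightarrow> continuous_on S f"
| "C_k_on (Suc k) S f \<longleftrightarrow> (\<forall>x\<in>S. f differentiable (at x)) \<and>
     (\<forall>v. C_k_on k S (\<lambda>x. frechet_derivative f (at x) v))"

definition smooth_on :: "'e::euclidean_space set \<Rightarrow> ('e \<Rightarrow> 'f::real_normed_vector) \<Rightarrow> bool" where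
  "smooth_on S f \<longleftrightarrow> (\<forall>k. C_k_on k S f)"


section \<open>Smooth manifolds\<close>

text \<open>A manifold is modelled on the Euclidean space \<open>'e\<close>, so that its dimension is
  \<open>DIM('e)\<close>. A chart is a pair of its domain and its coordinate map; the values of the
  coordinate map outside its domain are irrelevant.\<close>

record ('a, 'e) manifold =
  mtop :: "'a topology"
  atlas :: "('a set \<times> ('a \<Rightarrow> 'e)) set"

abbreviation points :: "('a, 'e) manifold \<Rightarrow> 'a set" where
  "points M \<equiv> topspace (mtop M)"

definition is_chart :: "'a topology \<Rightarrow> 'a set \<Rightarrow> ('a \<Rightarrow> 'e::euclidean_space) \<Rightarrow> bool" where
  "is_chart T V \<phi> \<longleftrightarrow> openin T V \<and> open (\<phi> ` V) \<and>
     homeomorphic_map (subtopology T V) (top_of_set (\<phi> ` V)) \<phi>"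

definition smooth_manifold :: "('a, 'e::euclidean_space) manifold \<Rightarrow> bool" where
  "smooth_manifold M \<longleftrightarrow>
     Hausdorff_space (mtop M) \<and> second_countable (mtop M) \<and>
     (\<forall>(V, \<phi>) \<in> atlas M. is_chart (mtop M) V \<phi>) \<and>
     (\<Union>(V, \<phi>) \<in> atlas M. V) = points M \<and>
     (\<forall>(V, \<phi>) \<in> atlas M. \<forall>(W, \<psi>) \<in> atlas M. smooth_on (\<phi> ` (V \<inter> W)) (\<psi> \<circ> inv_into V \<phi>))"

text \<open>Smoothness on an open subset U of M; the values of f outside U are irrelevant.\<close>

definition smooth_function_on :: "('a, 'e::euclidean_space) manifold \<Rightarrow> 'a set \<Rightarrow> ('a \<Rightarrow> real) \<Rightarrow> bool" where
  "smooth_function_on M U f \<longleftrightarrow>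
     (\<forall>(V, \<phi>) \<in> atlas M. smooth_on (\<phi> ` (U \<inter> V)) (f \<circ> inv_into V \<phi>))"

definition smooth_functions :: "('a, 'e::euclidean_space) manifold \<Rightarrow> ('a \<Rightarrow> real) set" where
  "smooth_functions M = {f. smooth_function_on M (points M) f}"


section \<open>Tangent vectors and vector fields\<close>

text \<open>A tangent vector at p is a derivation at p of the algebra of smooth functions. As functions
  are total in HOL, it is extended by 0 to arguments that are not smooth, so that equality
  of tangent vectors is equality of derivations. Sums and differences of tangent vectors and of
  vector fields are the pointwise ones of \<^theory>\<open>HOL-Library.Function_Algebras\<close>.\<close>

type_synonym 'a tvec = "('a \<Rightarrow> real) \<Rightarrow> real"
type_synonym 'a vfield = "'a \<Rightarrow> 'a tvec"
type_synonym 'a tensor2 = "'a \<Rightarrow> 'a tvec \<Rightarrow> 'a tvec \<Rightarrow> real"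
type_synonym 'a endo = "'a \<Rightarrow> 'a tvec \<Rightarrow> 'a tvec"

definition tscale :: "real \<Rightarrow> 'a tvec \<Rightarrow> 'a tvec" (infixr \<open>*\<^sub>t\<close> 75) where
  "c *\<^sub>t v = (\<lambda>f. c * v f)"

definition fscale :: "('a \<Rightarrow> real) \<Rightarrow> 'a vfield \<Rightarrow> 'a vfield" (infixr \<open>*\<^sub>f\<close> 75) where
  "f *\<^sub>f X = (\<lambda>p. f p *\<^sub>t X p)"

definition tangent_space :: "('a, 'e::euclidean_space) manifold \<Rightarrow> 'a \<Rightarrow> 'a tvec set" where
  "tangent_space M p = {v.
     (\<forall>f\<in>smooth_functions M. \<forall>h\<in>smooth_functions M. v (\<lambda>q. f q + h q) = v f + v h) \<and>
     (\<forall>f\<in>smooth_functions M. \<forall>c. v (\<lambda>q. c * f q) = c * v f) \<and>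
     (\<forall>f\<in>smooth_functions M. \<forall>h\<in>smooth_functions M.
        v (\<lambda>q. f q * h q) = f p * v h + h p * v f) \<and>
     (\<forall>f. f \<notin> smooth_functions M \<longrightarrow> v f = 0)}"

text \<open>Smooth vector fields over an open subset U of M.\<close>

definition vector_fields_on :: "('a, 'e::euclidean_space) manifold \<Rightarrow> 'a set \<Rightarrow> 'a vfield set" where
  "vector_fields_on M U = {X. (\<forall>p\<in>U. X p \<in> tangent_space M p) \<and>
     (\<forall>f\<in>smooth_functions M. smooth_function_on M U (\<lambda>p. X p f))}"

abbreviation vector_fields :: "('a, 'e::euclidean_space) manifold \<Rightarrow> 'a vfield set" where
  "vector_fields M \<equiv> vector_fields_on M (points M)"

definition field_deriv :: "'a vfield \<Rightarrow> ('a \<Rightarrow> real) \<Rightarrow> 'a \<Rightarrow> real" where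
  "field_deriv X f = (\<lambda>p. X p f)"

definition lie_bracket :: "'a vfield \<Rightarrow> 'a vfield \<Rightarrow> 'a vfield" where
  "lie_bracket X Y = (\<lambda>p f. X p (field_deriv Y f) - Y p (field_deriv X f))"


section \<open>Symmetric 2-tensors and Riemannian metrics\<close>

definition symmetric_2_tensor :: "('a, 'e::euclidean_space) manifold \<Rightarrow> 'a tensor2 \<Rightarrow> bool" where
  "symmetric_2_tensor M h \<longleftrightarrow>
     (\<forall>p\<in>points M. \<forall>u\<in>tangent_space M p. \<forall>v\<in>tangent_space M p. h p u v = h p v u) \<and>
     (\<forall>p\<in>points M. \<forall>u\<in>tangent_space M p. \<forall>v\<in>tangent_space M p. \<forall>w\<in>tangent_space M p.
        h p (u + v) w = h p u w + h p v w) \<and>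
     (\<forall>p\<in>points M. \<forall>u\<in>tangent_space M p. \<forall>v\<in>tangent_space M p. \<forall>c.
        h p (c *\<^sub>t u) v = c * h p u v) \<and>
     (\<forall>U X Y. openin (mtop M) U \<longrightarrow> X \<in> vector_fields_on M U \<longrightarrow> Y \<in> vector_fields_on M U \<longrightarrow>
        smooth_function_on M U (\<lambda>p. h p (X p) (Y p)))"

definition riemannian_metric :: "('a, 'e::euclidean_space) manifold \<Rightarrow> 'a tensor2 \<Rightarrow> bool" where
  "riemannian_metric M g \<longleftrightarrow> symmetric_2_tensor M g \<and>
     (\<forall>p\<in>points M. \<forall>v\<in>tangent_space M p. v \<noteq> 0 \<longrightarrow> g p v v > 0)"

definition tensor_of_endo :: "'a tensor2 \<Rightarrow> 'a endo \<Rightarrow> 'a tensor2" where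
  "tensor_of_endo g K = (\<lambda>p u v. g p (K p u) v)"


section \<open>The Levi-Civita connection\<close>

type_synonym 'a connection = "'a vfield \<Rightarrow> 'a vfield \<Rightarrow> 'a vfield"

text \<open>Vector fields are only compared at points of M, their values elsewhere being irrelevant.\<close>

definition affine_connection :: "('a, 'e::euclidean_space) manifold \<Rightarrow> 'a connection \<Rightarrow> bool" where
  "affine_connection M nabla \<longleftrightarrow>
     (\<forall>X\<in>vector_fields M. \<forall>Y\<in>vector_fields M. nabla X Y \<in> vector_fields M) \<and>
     (\<forall>X\<in>vector_fields M. \<forall>Y\<in>vector_fields M. \<forall>Z\<in>vector_fields M. \<forall>p\<in>points M.
        nabla (X + Y) Z p = (nabla X Z + nabla Y Z) p) \<and>
     (\<forall>f\<in>smooth_functions M. \<forall>X\<in>vector_fields M. \<forall>Z\<in>vector_fields M. \<forall>p\<in>points M.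
        nabla (f *\<^sub>f X) Z p = (f *\<^sub>f nabla X Z) p) \<and>
     (\<forall>X\<in>vector_fields M. \<forall>Y\<in>vector_fields M. \<forall>Z\<in>vector_fields M. \<forall>p\<in>points M.
        nabla X (Y + Z) p = (nabla X Y + nabla X Z) p) \<and>
     (\<forall>f\<in>smooth_functions M. \<forall>X\<in>vector_fields M. \<forall>Y\<in>vector_fields M. \<forall>p\<in>points M.
        nabla X (f *\<^sub>f Y) p = (field_deriv X f *\<^sub>f Y + f *\<^sub>f nabla X Y) p)"

definition levi_civita :: "('a, 'e::euclidean_space) manifold \<Rightarrow> 'a tensor2 \<Rightarrow> 'a connection \<Rightarrow> bool" where
  "levi_civita M g nabla \<longleftrightarrow> affine_connection M nabla \<and>
     (\<forall>X\<in>vector_fields M. \<forall>Y\<in>vector_fields M. \<forall>p\<in>points M.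
        (nabla X Y - nabla Y X) p = lie_bracket X Y p) \<and>
     (\<forall>X\<in>vector_fields M. \<forall>Y\<in>vector_fields M. \<forall>Z\<in>vector_fields M. \<forall>p\<in>points M.
        field_deriv X (\<lambda>q. g q (Y q) (Z q)) p
          = g p (nabla X Y p) (Z p) + g p (Y p) (nabla X Z p))"


section \<open>Killing tensors\<close>

text \<open>The function \<open>(\<nabla>\<^sub>X h)(Y, Z)\<close>.\<close>

definition cov_deriv :: "'a connection \<Rightarrow> 'a tensor2 \<Rightarrow> 'a vfield \<Rightarrow> 'a vfield \<Rightarrow> 'a vfield \<Rightarrow> 'a \<Rightarrow> real" where
  "cov_deriv nabla h X Y Z = (\<lambda>p. field_deriv X (\<lambda>q. h q (Y q) (Z q)) p
     - h p (nabla X Y p) (Z p) - h p (Y p) (nabla X Z p))"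

definition symmetrization3 ::
    "('a vfield \<Rightarrow> 'a vfield \<Rightarrow> 'a vfield \<Rightarrow> 'a \<Rightarrow> real) \<Rightarrow> 'a vfield \<Rightarrow> 'a vfield \<Rightarrow> 'a vfield \<Rightarrow> 'a \<Rightarrow> real" where
  "symmetrization3 T X Y Z = (\<lambda>p.
     (T X Y Z p + T X Z Y p + T Y X Z p + T Y Z X p + T Z X Y p + T Z Y X p) / 6)"

text \<open>The covariant derivative is tensorial and each tangent vector extends to a global smooth
  vector field, so quantifying over fields and points amounts to quantifying over tangent vectors.\<close>

definition killing_tensor :: "('a, 'e::euclidean_space) manifold \<Rightarrow> 'a connection \<Rightarrow> 'a tensor2 \<Rightarrow> bool" where
  "killing_tensor M nabla h \<longleftrightarrow> symmetric_2_tensor M h \<and>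
     (\<forall>X\<in>vector_fields M. \<forall>Y\<in>vector_fields M. \<forall>Z\<in>vector_fields M. \<forall>p\<in>points M.
        symmetrization3 (cov_deriv nabla h) X Y Z p = 0)"


section \<open>Distributions\<close>

definition is_basis :: "nat \<Rightarrow> (nat \<Rightarrow> 'a tvec) \<Rightarrow> 'a tvec set \<Rightarrow> bool" where
  "is_basis k b E \<longleftrightarrow>
     (\<forall>c. (\<Sum>i<k. c i *\<^sub>t b i) = 0 \<longrightarrow> (\<forall>i<k. c i = 0)) \<and>
     E = {v. \<exists>c. v = (\<Sum>i<k. c i *\<^sub>t b i)}"

text \<open>A smooth distribution of dimension k: a family of subspaces of the tangent spaces which has
  local smooth frames of length k.\<close>

definition distribution :: "('a, 'e::euclidean_space) manifold \<Rightarrow> nat \<Rightarrow> ('a \<Rightarrow> 'a tvec set) \<Rightarrow> bool" where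
  "distribution M k E \<longleftrightarrow>
     (\<forall>p\<in>points M. \<exists>U b. openin (mtop M) U \<and> p \<in> U \<and>
        (\<forall>i<k. b i \<in> vector_fields_on M U) \<and>
        (\<forall>q\<in>U. is_basis k (\<lambda>i. b i q) (E q)))"

definition sections :: "('a, 'e::euclidean_space) manifold \<Rightarrow> ('a \<Rightarrow> 'a tvec set) \<Rightarrow> 'a vfield set" where
  "sections M E = {X \<in> vector_fields M. \<forall>p\<in>points M. X p \<in> E p}"

definition orthogonal_complementary ::
    "('a, 'e::euclidean_space) manifold \<Rightarrow> 'a tensor2 \<Rightarrow> ('a \<Rightarrow> 'a tvec set) \<Rightarrow> ('a \<Rightarrow> 'a tvec set) \<Rightarrow> bool" where
  "orthogonal_complementary M g E1 E2 \<longleftrightarrow>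
     (\<forall>p\<in>points M. (\<forall>u\<in>E1 p. \<forall>w\<in>E2 p. g p u w = 0) \<and>
        (\<forall>v\<in>tangent_space M p. \<exists>!(u, w). u \<in> E1 p \<and> w \<in> E2 p \<and> v = u + w))"

definition orth_proj :: "'a tensor2 \<Rightarrow> ('a \<Rightarrow> 'a tvec set) \<Rightarrow> 'a endo" where
  "orth_proj g E = (\<lambda>p v. THE u. u \<in> E p \<and> (\<forall>w\<in>E p. g p (v - u) w = 0))"

end

theory Submission
  imports Defs
begin

text \<open>Write \<open>X = X\<^sub>1 + X\<^sub>2\<close> for the splitting of a field along \<open>E1\<close> and \<open>E2\<close>, and let
  \<open>h\<close> be the 2-tensor of \<open>K\<close>, so that \<open>h(Y, Z) = n\<^sub>2 g(Y\<^sub>1, Z\<^sub>1) - n\<^sub>1 g(Y\<^sub>2, Z\<^sub>2)\<close>.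
  Since \<open>\<nabla>\<close> is metric and \<open>g(Y\<^sub>1, Z\<^sub>2) = 0\<close>, all derivatives of functions drop out of
  \<open>\<nabla>h\<close> and only the second fundamental forms of the two distributions remain:
  \<open>(\<nabla>\<^sub>X h)(Y, Z) = (n\<^sub>1 + n\<^sub>2) (g(\<nabla>\<^sub>X Y\<^sub>1, Z\<^sub>2) + g(\<nabla>\<^sub>X Z\<^sub>1, Y\<^sub>2))\<close>
  (lemma \<open>cov_deriv_split_tensor\<close>).

  If \<open>h\<close> is Killing and \<open>X\<close> is a section of \<open>E1\<close>, evaluate the symmetrization on
  \<open>X, X, W\<^sub>2\<close>, where \<open>W = \<nabla>\<^sub>X X\<close>. Up to a nonzero factor this is
  \<open>g(W, W\<^sub>2) = g(W\<^sub>2, W\<^sub>2)\<close>, hence \<open>W\<^sub>2 = 0\<close>. The component \<open>W\<^sub>2\<close> of the field at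
  hand is already a global section of \<open>E2\<close>, so no extension of a vector to a section by bump
  functions is required. The claim for \<open>E2\<close> follows by exchanging the roles of the two
  distributions, which changes the sign of \<open>h\<close>.

  Conversely, polarizing the two conditions shows that \<open>g(\<nabla>\<^sub>X Y, Z)\<close> is skew in \<open>X, Y\<close>
  when both are sections of one distribution and \<open>Z\<close> is a section of the other. Splitting
  also the direction of differentiation, the complete symmetrization of \<open>\<nabla>h\<close> becomes a sum of
  such terms symmetrized in \<open>X, Y\<close>, so it vanishes.

  Both directions need that the components of a smooth field are smooth (lemma \<open>split_field\<close>);
  this is local and follows by the Gram--Schmidt process applied to a smooth frame
  (lemma \<open>smooth_frame_projection\<close>).\<close>

section \<open>Calculus of smooth functions on open sets\<close>

lemma C_k_on_subset: "C_k_on k S f \<Longrightarrow> T \<subseteq> S \<Longrightarrow> C_k_on k T f"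
proof (induction k arbitrary: f)
  case 0
  then show ?case by (simp add: continuous_on_subset)
next
  case (Suc k)
  then show ?case by (simp add: subset_iff)
qed

text \<open>Continuity of the highest derivatives propagates down because differentiable functions are
  continuous.\<close>

lemma C_k_on_Suc_imp: "C_k_on (Suc k) S f \<Longrightarrow> C_k_on k S f"
proof (induction k arbitrary: f)
  case 0
  then show ?case
    by (simp add: continuous_at_imp_continuous_on differentiable_imp_continuous_within)
next
  case (Suc k)
  then show ?case
    unfolding C_k_on.simps(2)[of "Suc k"] C_k_on.simps(2)[of k S f] by blast
qed

text \<open>Openness of \<open>S\<close> matters: the derivative at a point of \<open>S\<close> is the full derivative, which
  also depends on the values of the function around that point.\<close>

lemma C_k_on_cong_imp:
  assumes "open S" "\<And>x. x \<in> S \<Longrightarrow> f x = h x" "C_k_on k S f"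
  shows "C_k_on k S h"
  using assms(2,3)
proof (induction k arbitrary: f h)
  case 0
  then show ?case by (simp cong: continuous_on_cong)
next
  case (Suc k)
  have der: "(h has_derivative frechet_derivative f (at x)) (at x)" if "x \<in> S" for x
    using Suc.prems that assms(1)
    by (auto intro: has_derivative_transform_within_open simp: frechet_derivative_works)
  have eq: "frechet_derivative f (at x) = frechet_derivative h (at x)" if "x \<in> S" for x
    using der[OF that] by (rule frechet_derivative_at)
  have "C_k_on k S (\<lambda>x. frechet_derivative h (at x) v)" for v
    by (rule Suc.IH[of "\<lambda>x. frechet_derivative f (at x) v"]) (use eq Suc.prems in auto)
  then show ?case
    using der by (auto simp: differentiable_def)
qed

lemma C_k_on_const: "C_k_on k S (\<lambda>x. c)"
  by (induction k arbitrary: c) auto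

lemma C_k_on_add:
  assumes "open S" "C_k_on k S f" "C_k_on k S h"
  shows "C_k_on k S (\<lambda>x. f x + h x)"
  using assms(2,3)
proof (induction k arbitrary: f h)
  case 0
  then show ?case by (simp add: continuous_on_add)
next
  case (Suc k)
  have der: "((\<lambda>x. f x + h x) has_derivative
      (\<lambda>v. frechet_derivative f (at x) v + frechet_derivative h (at x) v)) (at x)" if "x \<in> S" for x
    using Suc.prems that
    by (intro has_derivative_add) (auto simp: frechet_derivative_works[symmetric])
  have "C_k_on k S (\<lambda>x. frechet_derivative (\<lambda>x. f x + h x) (at x) v)" for v
  proof (rule C_k_on_cong_imp[OF assms(1)])
    show "C_k_on k S (\<lambda>x. frechet_derivative f (at x) v + frechet_derivative h (at x) v)"
      using Suc by auto
    show "frechet_derivative f (at x) v + frechet_derivative h (at x) v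
        = frechet_derivative (\<lambda>x. f x + h x) (at x) v" if "x \<in> S" for x
      using frechet_derivative_at[OF der[OF that], symmetric] by simp
  qed
  then show ?case
    using der by (auto simp: differentiable_def)
qed

lemma C_k_on_mult:
  fixes f h :: "'e::euclidean_space \<Rightarrow> real"
  assumes "open S" "C_k_on k S f" "C_k_on k S h"
  shows "C_k_on k S (\<lambda>x. f x * h x)"
  using assms(2,3)
proof (induction k arbitrary: f h)
  case 0
  then show ?case by (simp add: continuous_on_mult)
next
  case (Suc k)
  have der: "((\<lambda>x. f x * h x) has_derivative
      (\<lambda>v. f x * frechet_derivative h (at x) v + frechet_derivative f (at x) v * h x)) (at x)"
    if "x \<in> S" for x
    using Suc.prems that
    by (intro has_derivative_mult) (auto simp: frechet_derivative_works[symmetric])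
  have "C_k_on k S (\<lambda>x. frechet_derivative (\<lambda>x. f x * h x) (at x) v)" for v
  proof (rule C_k_on_cong_imp[OF assms(1)])
    show "C_k_on k S (\<lambda>x. f x * frechet_derivative h (at x) v + frechet_derivative f (at x) v * h x)"
      by (intro C_k_on_add[OF assms(1)] Suc.IH)
        (use Suc.prems C_k_on_Suc_imp in auto)
    show "f x * frechet_derivative h (at x) v + frechet_derivative f (at x) v * h x
        = frechet_derivative (\<lambda>x. f x * h x) (at x) v" if "x \<in> S" for x
      using frechet_derivative_at[OF der[OF that], symmetric] by simp
  qed
  then show ?case
    using der by (auto simp: differentiable_def)
qed

text \<open>The derivative of \<open>1 / f\<close> is \<open>- f' / f\<^sup>2\<close>, so one more derivative of the inverse costs
  products of functions already known to be of class \<open>k\<close>.\<close>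

lemma C_k_on_inverse:
  fixes f :: "'e::euclidean_space \<Rightarrow> real"
  assumes "open S" "\<And>x. x \<in> S \<Longrightarrow> f x \<noteq> 0" "C_k_on k S f"
  shows "C_k_on k S (\<lambda>x. inverse (f x))"
  using assms(3)
proof (induction k)
  case 0
  then show ?case using assms(2) by (auto intro: continuous_on_inverse)
next
  case (Suc k)
  have der: "((\<lambda>x. inverse (f x)) has_derivative
      (\<lambda>v. - (inverse (f x) * frechet_derivative f (at x) v * inverse (f x)))) (at x)" if "x \<in> S" for x
  proof -
    have "(f has_derivative frechet_derivative f (at x)) (at x)"
      using Suc.prems that by (simp add: frechet_derivative_works[symmetric])
    from Deriv.has_derivative_inverse[OF assms(2)[OF that] this] show ?thesis .
  qed
  have "C_k_on k S (\<lambda>x. frechet_derivative (\<lambda>x. inverse (f x)) (at x) v)" for v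
  proof (rule C_k_on_cong_imp[OF assms(1)])
    show "C_k_on k S (\<lambda>x. - 1 * ((inverse (f x) * frechet_derivative f (at x) v) * inverse (f x)))"
      using Suc.IH[OF C_k_on_Suc_imp[OF Suc.prems]] Suc.prems
      by (intro C_k_on_mult[OF assms(1)] C_k_on_const) auto
    show "- 1 * ((inverse (f x) * frechet_derivative f (at x) v) * inverse (f x))
        = frechet_derivative (\<lambda>x. inverse (f x)) (at x) v" if "x \<in> S" for x
      using frechet_derivative_at[OF der[OF that], symmetric] by simp
  qed
  then show ?case
    using der by (auto simp: differentiable_def)
qed

lemma C_k_on_local:
  assumes "\<And>x. x \<in> S \<Longrightarrow> \<exists>T. open T \<and> x \<in> T \<and> C_k_on k T f"
  shows "C_k_on k S f"
  using assms
proof (induction k arbitrary: f)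
  case 0
  have "isCont f x" if x: "x \<in> S" for x
  proof -
    obtain T where "open T" "x \<in> T" "continuous_on T f"
      using 0[OF x] by auto
    then show ?thesis by (simp add: continuous_on_eq_continuous_at)
  qed
  then show ?case by (simp add: continuous_at_imp_continuous_on)
next
  case (Suc k)
  have "f differentiable (at x)" if x: "x \<in> S" for x
    using Suc.prems[OF x] by auto
  moreover have "C_k_on k S (\<lambda>x. frechet_derivative f (at x) v)" for v
  proof (rule Suc.IH)
    fix x assume "x \<in> S"
    from Suc.prems[OF this] obtain T where "open T" "x \<in> T" "C_k_on (Suc k) T f" by blast
    then show "\<exists>T. open T \<and> x \<in> T \<and> C_k_on k T (\<lambda>x. frechet_derivative f (at x) v)"
      by (intro exI[of _ T]) simp
  qed
  ultimately show ?case by simp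
qed


section \<open>Smooth functions and vector fields on a manifold\<close>

locale smooth_mfd =
  fixes M :: "('a, 'e::euclidean_space) manifold"
  assumes smooth_M: "smooth_manifold M"
begin

lemma chart_inv:
  assumes "(V, \<phi>) \<in> atlas M" "x \<in> V"
  shows "inv_into V \<phi> (\<phi> x) = x"
proof -
  have ch: "is_chart (mtop M) V \<phi>"
    using smooth_M assms(1) by (auto simp: smooth_manifold_def)
  then have "V \<subseteq> points M"
    by (simp add: is_chart_def openin_subset)
  then have "inj_on \<phi> V"
    using ch by (auto simp: is_chart_def homeomorphic_eq_everything_map Int_absorb1)
  then show ?thesis using assms(2) by simp
qed

lemma open_chart_image:
  assumes "(V, \<phi>) \<in> atlas M" "openin (mtop M) U"
  shows "open (\<phi> ` (U \<inter> V))"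
proof -
  have ch: "is_chart (mtop M) V \<phi>"
    using smooth_M assms(1) by (auto simp: smooth_manifold_def)
  have "openin (subtopology (mtop M) V) (U \<inter> V)"
    using assms(2) by (auto simp: openin_subtopology)
  moreover have "open_map (subtopology (mtop M) V) (top_of_set (\<phi> ` V)) \<phi>"
    using ch by (simp add: is_chart_def homeomorphic_eq_everything_map)
  ultimately have "openin (top_of_set (\<phi> ` V)) (\<phi> ` (U \<inter> V))"
    by (simp add: open_map_def)
  then show ?thesis
    using ch openin_open_trans by (auto simp: is_chart_def)
qed

lemma smooth_function_on_iff:
  "smooth_function_on M U f \<longleftrightarrow>
    (\<forall>V \<phi> k. (V, \<phi>) \<in> atlas M \<longrightarrow> C_k_on k (\<phi> ` (U \<inter> V)) (\<lambda>x. f (inv_into V \<phi> x)))"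
  by (auto simp: smooth_function_on_def smooth_on_def o_def)

lemma smooth_function_on_subset:
  "smooth_function_on M U f \<Longrightarrow> W \<subseteq> U \<Longrightarrow> smooth_function_on M W f"
  unfolding smooth_function_on_iff by (meson C_k_on_subset Int_mono image_mono order_refl)

lemma smooth_function_on_cong:
  assumes "openin (mtop M) U" "smooth_function_on M U f" "\<And>p. p \<in> U \<Longrightarrow> f p = h p"
  shows "smooth_function_on M U h"
  unfolding smooth_function_on_iff
proof (intro allI impI)
  fix V \<phi> k assume V: "(V, \<phi>) \<in> atlas M"
  show "C_k_on k (\<phi> ` (U \<inter> V)) (\<lambda>x. h (inv_into V \<phi> x))"
    by (rule C_k_on_cong_imp[OF open_chart_image[OF V assms(1)], of "\<lambda>x. f (inv_into V \<phi> x)"])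
      (use assms V chart_inv[OF V] in \<open>auto simp: smooth_function_on_iff\<close>)
qed

lemma smooth_function_on_const: "smooth_function_on M U (\<lambda>p. c)"
  by (simp add: smooth_function_on_iff C_k_on_const)

lemma smooth_function_on_add:
  assumes "openin (mtop M) U" "smooth_function_on M U f" "smooth_function_on M U h"
  shows "smooth_function_on M U (\<lambda>p. f p + h p)"
  using assms unfolding smooth_function_on_iff by (simp add: C_k_on_add open_chart_image)

lemma smooth_function_on_mult:
  assumes "openin (mtop M) U" "smooth_function_on M U f" "smooth_function_on M U h"
  shows "smooth_function_on M U (\<lambda>p. f p * h p)"
  using assms unfolding smooth_function_on_iff by (simp add: C_k_on_mult open_chart_image)

lemma smooth_function_on_diff:
  assumes "openin (mtop M) U" "smooth_function_on M U f" "smooth_function_on M U h"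
  shows "smooth_function_on M U (\<lambda>p. f p - h p)"
  using smooth_function_on_add[OF assms(1,2)
      smooth_function_on_mult[OF assms(1) smooth_function_on_const[of _ "-1"] assms(3)]]
  by simp

lemma smooth_function_on_divide:
  assumes "openin (mtop M) U" "smooth_function_on M U f" "smooth_function_on M U h"
    and nz: "\<And>p. p \<in> U \<Longrightarrow> h p \<noteq> 0"
  shows "smooth_function_on M U (\<lambda>p. f p / h p)"
proof -
  have "smooth_function_on M U (\<lambda>p. inverse (h p))"
    unfolding smooth_function_on_iff
  proof (intro allI impI)
    fix V \<phi> k assume V: "(V, \<phi>) \<in> atlas M"
    show "C_k_on k (\<phi> ` (U \<inter> V)) (\<lambda>x. inverse (h (inv_into V \<phi> x)))"
      by (rule C_k_on_inverse[OF open_chart_image[OF V assms(1)]])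
        (use assms V chart_inv[OF V] in \<open>auto simp: smooth_function_on_iff\<close>)
  qed
  from smooth_function_on_mult[OF assms(1,2) this] show ?thesis
    by (simp add: divide_inverse)
qed

lemma smooth_function_on_local:
  assumes "\<And>p. p \<in> U \<Longrightarrow> \<exists>W. openin (mtop M) W \<and> p \<in> W \<and> smooth_function_on M W f"
  shows "smooth_function_on M U f"
  unfolding smooth_function_on_iff
proof (intro allI impI)
  fix V \<phi> k assume V: "(V, \<phi>) \<in> atlas M"
  show "C_k_on k (\<phi> ` (U \<inter> V)) (\<lambda>x. f (inv_into V \<phi> x))"
  proof (rule C_k_on_local)
    fix x assume "x \<in> \<phi> ` (U \<inter> V)"
    then obtain p where p: "p \<in> U" "p \<in> V" "x = \<phi> p" by auto
    from assms[OF p(1)] obtain W where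
      W: "openin (mtop M) W" "p \<in> W" "smooth_function_on M W f" by blast
    show "\<exists>T. open T \<and> x \<in> T \<and> C_k_on k T (\<lambda>x. f (inv_into V \<phi> x))"
      by (rule exI[of _ "\<phi> ` (W \<inter> V)"])
        (use W p V open_chart_image[OF V W(1)] in \<open>auto simp: smooth_function_on_iff\<close>)
  qed
qed

lemma tangent_add:
  "u \<in> tangent_space M p \<Longrightarrow> v \<in> tangent_space M p \<Longrightarrow> u + v \<in> tangent_space M p"
  by (auto simp: tangent_space_def algebra_simps)

lemma tangent_scale:
  "u \<in> tangent_space M p \<Longrightarrow> c *\<^sub>t u \<in> tangent_space M p"
  by (auto simp: tangent_space_def tscale_def algebra_simps)

lemma tangent_zero: "0 \<in> tangent_space M p"
  by (auto simp: tangent_space_def)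

lemma tangent_diff:
  "u \<in> tangent_space M p \<Longrightarrow> v \<in> tangent_space M p \<Longrightarrow> u - v \<in> tangent_space M p"
  by (auto simp: tangent_space_def algebra_simps)

lemma tangent_apply_add:
  assumes "v \<in> tangent_space M p" "f \<in> smooth_functions M" "h \<in> smooth_functions M"
  shows "v (\<lambda>q. f q + h q) = v f + v h"
  using assms by (simp add: tangent_space_def)

lemma tangent_apply_scale:
  assumes "v \<in> tangent_space M p" "f \<in> smooth_functions M"
  shows "v (\<lambda>q. c * f q) = c * v f"
  using assms by (simp add: tangent_space_def)

lemma smooth_functions_const: "(\<lambda>q. c) \<in> smooth_functions M"
  by (simp add: smooth_functions_def smooth_function_on_const)

lemma tangent_apply_zero: "v \<in> tangent_space M p \<Longrightarrow> v (\<lambda>q. 0) = 0"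
  using tangent_apply_scale[OF _ smooth_functions_const, of v p 0 0] by simp

text \<open>Derivations see a function only through its values on the manifold: a function \<open>d\<close> vanishing
  there equals \<open>ind d\<close>, where \<open>ind\<close> is the indicator function of the complement, and by the product
  rule a derivation kills \<open>ind d\<close> because both factors vanish at \<open>p\<close>.\<close>

lemma tangent_cong:
  assumes v: "v \<in> tangent_space M p" and p: "p \<in> points M"
    and f: "f \<in> smooth_functions M" and eq: "\<And>q. q \<in> points M \<Longrightarrow> f q = h q"
  shows "v f = v h"
proof -
  define d where "d = (\<lambda>q. h q - f q)"
  define ind where "ind = (\<lambda>q. if q \<in> points M then 0 else 1 :: real)"
  have d: "d \<in> smooth_functions M" and ind: "ind \<in> smooth_functions M"
    unfolding smooth_functions_def mem_Collect_eq
    by (rule smooth_function_on_cong[OF openin_topspace smooth_function_on_const[of _ 0]],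
        simp add: d_def ind_def eq)+
  have "(\<lambda>q. ind q * d q) = d"
    by (auto simp: d_def ind_def eq)
  moreover have "v (\<lambda>q. ind q * d q) = ind p * v d + d p * v ind"
    using v d ind by (simp add: tangent_space_def)
  ultimately have "v d = 0"
    using p by (simp add: ind_def d_def eq)
  moreover have "v (\<lambda>q. f q + d q) = v f + v d"
    using v f d by (simp add: tangent_space_def)
  ultimately show ?thesis by (simp add: d_def)
qed

lemma vector_fields_on_subset:
  "X \<in> vector_fields_on M U \<Longrightarrow> W \<subseteq> U \<Longrightarrow> X \<in> vector_fields_on M W"
  unfolding vector_fields_on_def using smooth_function_on_subset by blast

lemma vector_fields_on_add:
  "openin (mtop M) U \<Longrightarrow> X \<in> vector_fields_on M U \<Longrightarrow> Y \<in> vector_fields_on M U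
    \<Longrightarrow> X + Y \<in> vector_fields_on M U"
  by (simp add: vector_fields_on_def tangent_add smooth_function_on_add)

lemma vector_fields_on_diff:
  "openin (mtop M) U \<Longrightarrow> X \<in> vector_fields_on M U \<Longrightarrow> Y \<in> vector_fields_on M U
    \<Longrightarrow> X - Y \<in> vector_fields_on M U"
  by (simp add: vector_fields_on_def tangent_diff smooth_function_on_diff)

lemma vector_fields_on_zero: "(\<lambda>p. 0) \<in> vector_fields_on M U"
  by (simp add: vector_fields_on_def tangent_zero smooth_function_on_const)

lemma vector_fields_on_fscale:
  "openin (mtop M) U \<Longrightarrow> smooth_function_on M U f \<Longrightarrow> X \<in> vector_fields_on M U
    \<Longrightarrow> f *\<^sub>f X \<in> vector_fields_on M U"
  by (simp add: vector_fields_on_def fscale_def tangent_scale)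
    (simp add: tscale_def smooth_function_on_mult)

lemma vector_fields_on_local:
  assumes "\<And>p. p \<in> U \<Longrightarrow> \<exists>W Y. openin (mtop M) W \<and> p \<in> W \<and> Y \<in> vector_fields_on M W
      \<and> (\<forall>q\<in>W. Y q = X q)"
  shows "X \<in> vector_fields_on M U"
  unfolding vector_fields_on_def
proof (intro CollectI conjI ballI)
  fix p assume "p \<in> U"
  from assms[OF this] obtain W Y where W: "p \<in> W" "Y \<in> vector_fields_on M W" "\<forall>q\<in>W. Y q = X q"
    by blast
  have "Y p \<in> tangent_space M p" using W(1,2) by (simp add: vector_fields_on_def)
  with W(1,3) show "X p \<in> tangent_space M p" by simp
next
  fix f assume f: "f \<in> smooth_functions M"
  show "smooth_function_on M U (\<lambda>p. X p f)"
  proof (rule smooth_function_on_local)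
    fix p assume "p \<in> U"
    from assms[OF this] obtain W Y where W: "openin (mtop M) W" "p \<in> W"
      "Y \<in> vector_fields_on M W" "\<forall>q\<in>W. Y q = X q" by blast
    have "smooth_function_on M W (\<lambda>p. Y p f)"
      using W(3) f by (simp add: vector_fields_on_def)
    then have "smooth_function_on M W (\<lambda>p. X p f)"
      by (rule smooth_function_on_cong[OF W(1)]) (simp add: W(4))
    with W(1,2) show "\<exists>W. openin (mtop M) W \<and> p \<in> W \<and> smooth_function_on M W (\<lambda>p. X p f)"
      by (intro exI[of _ W]) simp
  qed
qed

end


section \<open>Linear algebra in the tangent spaces\<close>

locale riemannian_mfd = smooth_mfd M for M :: "('a, 'e::euclidean_space) manifold" +
  fixes g :: "'a tensor2"
  assumes riem: "riemannian_metric M g"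
begin

lemma metric_sym:
  "p \<in> points M \<Longrightarrow> u \<in> tangent_space M p \<Longrightarrow> v \<in> tangent_space M p \<Longrightarrow> g p u v = g p v u"
  using riem by (simp add: riemannian_metric_def symmetric_2_tensor_def)

lemma metric_add_left:
  "p \<in> points M \<Longrightarrow> u \<in> tangent_space M p \<Longrightarrow> v \<in> tangent_space M p \<Longrightarrow> w \<in> tangent_space M p
    \<Longrightarrow> g p (u + v) w = g p u w + g p v w"
  using riem by (simp add: riemannian_metric_def symmetric_2_tensor_def)

lemma metric_scale_left:
  "p \<in> points M \<Longrightarrow> u \<in> tangent_space M p \<Longrightarrow> v \<in> tangent_space M p \<Longrightarrow> g p (c *\<^sub>t u) v = c * g p u v"
  using riem by (simp add: riemannian_metric_def symmetric_2_tensor_def)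

lemma metric_add_right:
  "p \<in> points M \<Longrightarrow> u \<in> tangent_space M p \<Longrightarrow> v \<in> tangent_space M p \<Longrightarrow> w \<in> tangent_space M p
    \<Longrightarrow> g p w (u + v) = g p w u + g p w v"
  by (simp add: metric_sym[of p w] tangent_add metric_add_left)

lemma metric_scale_right:
  "p \<in> points M \<Longrightarrow> u \<in> tangent_space M p \<Longrightarrow> v \<in> tangent_space M p \<Longrightarrow> g p v (c *\<^sub>t u) = c * g p v u"
  by (simp add: metric_sym[of p v] tangent_scale metric_scale_left)

lemma metric_diff_left:
  assumes "p \<in> points M" "u \<in> tangent_space M p" "v \<in> tangent_space M p" "w \<in> tangent_space M p"
  shows "g p (u - v) w = g p u w - g p v w"
  using metric_add_left[of p "u - v" v w] assms by (simp add: tangent_diff)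

lemma metric_zero_left: "p \<in> points M \<Longrightarrow> v \<in> tangent_space M p \<Longrightarrow> g p 0 v = 0"
  using metric_diff_left[of p 0 0 v] by (simp add: tangent_zero)

lemma metric_zero_right: "p \<in> points M \<Longrightarrow> v \<in> tangent_space M p \<Longrightarrow> g p v 0 = 0"
  by (simp add: metric_sym[of p v] tangent_zero metric_zero_left)

lemma metric_eq_0: "p \<in> points M \<Longrightarrow> v \<in> tangent_space M p \<Longrightarrow> g p v v = 0 \<Longrightarrow> v = 0"
  using riem by (force simp: riemannian_metric_def)

lemma smooth_metric:
  "openin (mtop M) U \<Longrightarrow> X \<in> vector_fields_on M U \<Longrightarrow> Y \<in> vector_fields_on M U
    \<Longrightarrow> smooth_function_on M U (\<lambda>p. g p (X p) (Y p))"
  using riem by (simp add: riemannian_metric_def symmetric_2_tensor_def)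

end

definition tspan :: "nat \<Rightarrow> (nat \<Rightarrow> 'a tvec) \<Rightarrow> 'a tvec set" where
  "tspan k b = {v. \<exists>c. v = (\<Sum>i<k. c i *\<^sub>t b i)}"

lemma tscale_simps:
  "0 *\<^sub>t v = 0" "1 *\<^sub>t v = v" "c *\<^sub>t 0 = 0" "(- 1) *\<^sub>t v = - v" "c *\<^sub>t d *\<^sub>t v = (c * d) *\<^sub>t v"
  "c *\<^sub>t (u + v) = c *\<^sub>t u + c *\<^sub>t v" "(c + d) *\<^sub>t v = c *\<^sub>t v + d *\<^sub>t v"
  by (auto simp: tscale_def fun_eq_iff algebra_simps)

lemma tscale_sum: "c *\<^sub>t (\<Sum>i\<in>A. f i) = (\<Sum>i\<in>A. c *\<^sub>t f i)"
  by (induction A rule: infinite_finite_induct)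
    (simp_all only: tscale_simps sum.infinite sum.empty sum.insert not_False_eq_True)

lemma tspan_zero: "0 \<in> tspan k b"
  by (auto simp: tspan_def tscale_simps intro!: exI[of _ "\<lambda>_. 0"])

lemma tspan_add: "u \<in> tspan k b \<Longrightarrow> v \<in> tspan k b \<Longrightarrow> u + v \<in> tspan k b"
proof -
  assume "u \<in> tspan k b" "v \<in> tspan k b"
  then obtain c d where "u = (\<Sum>i<k. c i *\<^sub>t b i)" "v = (\<Sum>i<k. d i *\<^sub>t b i)"
    by (auto simp: tspan_def)
  then have "u + v = (\<Sum>i<k. (c i + d i) *\<^sub>t b i)"
    by (simp add: tscale_simps sum.distrib)
  then show ?thesis unfolding tspan_def by (intro CollectI exI)
qed

lemma tspan_scale: "u \<in> tspan k b \<Longrightarrow> c *\<^sub>t u \<in> tspan k b"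
proof -
  assume "u \<in> tspan k b"
  then obtain d where "u = (\<Sum>i<k. d i *\<^sub>t b i)"
    by (auto simp: tspan_def)
  then have "c *\<^sub>t u = (\<Sum>i<k. (c * d i) *\<^sub>t b i)"
    by (simp add: tscale_simps tscale_sum)
  then show ?thesis unfolding tspan_def by (intro CollectI exI)
qed

lemma tspan_diff: "u \<in> tspan k b \<Longrightarrow> v \<in> tspan k b \<Longrightarrow> u - v \<in> tspan k b"
  using tspan_add[OF _ tspan_scale[of v k b "-1"]] by (simp add: tscale_simps)

lemma tspan_Suc: "tspan (Suc k) b = {u + c *\<^sub>t b k | u c. u \<in> tspan k b}"
proof -
  have "u + d *\<^sub>t b k \<in> tspan (Suc k) b" if u: "u \<in> tspan k b" for u d
  proof -
    obtain c where "u = (\<Sum>i<k. c i *\<^sub>t b i)"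
      using u by (auto simp: tspan_def)
    then have "u + d *\<^sub>t b k = (\<Sum>i<Suc k. (c(k := d)) i *\<^sub>t b i)"
      by simp
    then show ?thesis unfolding tspan_def by (intro CollectI exI)
  qed
  moreover have "\<exists>u c. v = u + c *\<^sub>t b k \<and> u \<in> tspan k b" if "v \<in> tspan (Suc k) b" for v
    using that by (auto simp: tspan_def)
  ultimately show ?thesis by blast
qed

context smooth_mfd
begin

lemma tspan_tangent:
  assumes "\<And>i. i < k \<Longrightarrow> b i \<in> tangent_space M p" "v \<in> tspan k b"
  shows "v \<in> tangent_space M p"
  using assms
proof (induction k arbitrary: v)
  case 0
  then have "v = 0" by (simp add: tspan_def)
  then show ?case by (simp only: tangent_zero)
next
  case (Suc k)
  then show ?case
    by (auto simp: tspan_Suc intro!: tangent_add tangent_scale)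
qed

end


section \<open>Orthogonal projection onto a distribution\<close>

context riemannian_mfd
begin

text \<open>One step of the Gram--Schmidt process: if \<open>Q\<close> is the projection of the last frame field
  \<open>b k\<close> onto the span of the others, then \<open>e = b k - Q\<close> is orthogonal to these and vanishes
  nowhere by linear independence. So the projection of \<open>X\<close> onto the larger span is obtained
  from the one onto the smaller span by adding the multiple of \<open>e\<close> with coefficient
  \<open>g(X, e) / g(e, e)\<close>, which is smooth. Not normalizing \<open>e\<close> avoids square roots.\<close>

lemma smooth_frame_projection:
  assumes U: "openin (mtop M) U"
    and "\<And>i. i < k \<Longrightarrow> b i \<in> vector_fields_on M U"
    and "\<And>q c. q \<in> U \<Longrightarrow> (\<Sum>i<k. c i *\<^sub>t b i q) = 0 \<Longrightarrow> \<forall>i<k. c i = 0"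
    and "X \<in> vector_fields_on M U"
  shows "\<exists>P\<in>vector_fields_on M U. \<forall>q\<in>U. P q \<in> tspan k (\<lambda>i. b i q)
    \<and> (\<forall>w\<in>tspan k (\<lambda>i. b i q). g q (X q - P q) w = 0)"
  using assms(2-)
proof (induction k arbitrary: X)
  case 0
  show ?case
  proof (intro bexI[of _ "\<lambda>_. 0"] ballI conjI)
    fix q w assume q: "q \<in> U" and "w \<in> tspan 0 (\<lambda>i. b i q)"
    then have w: "w = 0" by (simp add: tspan_def)
    have "q \<in> points M" using U q openin_subset by blast
    moreover have "X q - 0 \<in> tangent_space M q"
      using 0(3) q by (simp add: vector_fields_on_def tangent_diff tangent_zero)
    ultimately show "g q (X q - 0) w = 0"
      unfolding w by (rule metric_zero_right)
  qed (simp_all only: tspan_zero vector_fields_on_zero)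
next
  case (Suc k)
  have UM: "q \<in> points M" if "q \<in> U" for q
    using U that openin_subset by blast
  have T: "Y q \<in> tangent_space M q" if "Y \<in> vector_fields_on M U" "q \<in> U" for Y q
    using that by (simp add: vector_fields_on_def)
  have b: "b k \<in> vector_fields_on M U" "\<And>i. i < k \<Longrightarrow> b i \<in> vector_fields_on M U"
    using Suc.prems(1) by auto
  have indep: "\<forall>i<k. c i = 0" if "q \<in> U" "(\<Sum>i<k. c i *\<^sub>t b i q) = 0" for q c
  proof -
    have "\<forall>i<Suc k. (c(k := 0)) i = 0"
      using that(2) by (intro Suc.prems(2)[OF that(1)]) (simp add: tscale_simps)
    then show ?thesis by (simp add: less_Suc_eq)
  qed
  have IH: "\<exists>P\<in>vector_fields_on M U. \<forall>q\<in>U. P q \<in> tspan k (\<lambda>i. b i q)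
      \<and> (\<forall>w\<in>tspan k (\<lambda>i. b i q). g q (Y q - P q) w = 0)" if Y: "Y \<in> vector_fields_on M U" for Y
  proof (rule Suc.IH[OF _ _ Y])
    show "b i \<in> vector_fields_on M U" if "i < k" for i by (rule b(2)[OF that])
    show "\<forall>i<k. c i = 0" if "q \<in> U" "(\<Sum>i<k. c i *\<^sub>t b i q) = 0" for q c by (rule indep[OF that])
  qed
  obtain Q where Q: "Q \<in> vector_fields_on M U"
    and Qs: "\<And>q. q \<in> U \<Longrightarrow> Q q \<in> tspan k (\<lambda>i. b i q)"
    and Qo: "\<And>q w. q \<in> U \<Longrightarrow> w \<in> tspan k (\<lambda>i. b i q) \<Longrightarrow> g q (b k q - Q q) w = 0"
    using IH[OF b(1)] by blast
  obtain P where P: "P \<in> vector_fields_on M U"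
    and Ps: "\<And>q. q \<in> U \<Longrightarrow> P q \<in> tspan k (\<lambda>i. b i q)"
    and Po: "\<And>q w. q \<in> U \<Longrightarrow> w \<in> tspan k (\<lambda>i. b i q) \<Longrightarrow> g q (X q - P q) w = 0"
    using IH[OF Suc.prems(3)] by blast
  define e where "e = b k - Q"
  have e: "e \<in> vector_fields_on M U"
    unfolding e_def using U b(1) Q by (rule vector_fields_on_diff)
  have e0: "g q (e q) (e q) \<noteq> 0" if q: "q \<in> U" for q
  proof
    assume "g q (e q) (e q) = 0"
    then have "e q = 0"
      using metric_eq_0 UM[OF q] T[OF e q] by blast
    moreover obtain c where "Q q = (\<Sum>i<k. c i *\<^sub>t b i q)"
      using Qs[OF q] by (auto simp: tspan_def)
    \<comment> \<open>\<open>e q = 0\<close> would express \<open>b k q\<close> through the other frame vectors, a nontrivial relation.\<close>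
    ultimately have "(\<Sum>i<Suc k. (c(k := -1)) i *\<^sub>t b i q) = 0"
      by (simp add: e_def tscale_simps)
    from Suc.prems(2)[OF q this] show False by auto
  qed
  define \<phi> where "\<phi> = (\<lambda>q. g q (X q - P q) (e q) / g q (e q) (e q))"
  have XP: "X - P \<in> vector_fields_on M U"
    using U Suc.prems(3) P by (rule vector_fields_on_diff)
  have \<phi>: "smooth_function_on M U \<phi>"
    unfolding \<phi>_def
    using smooth_function_on_divide[OF U smooth_metric[OF U XP e] smooth_metric[OF U e e] e0] by simp
  define P' where "P' = P + \<phi> *\<^sub>f e"
  have P': "P' \<in> vector_fields_on M U"
    unfolding P'_def by (intro vector_fields_on_add vector_fields_on_fscale U P \<phi> e)
  have "P' q \<in> tspan (Suc k) (\<lambda>i. b i q)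
    \<and> (\<forall>w\<in>tspan (Suc k) (\<lambda>i. b i q). g q (X q - P' q) w = 0)" if q: "q \<in> U" for q
  proof
    have be: "b k q = Q q + e q" by (simp add: e_def)
    have P'q: "P' q = P q + \<phi> q *\<^sub>t e q" by (simp add: P'_def fscale_def)
    have "P' q = (P q - \<phi> q *\<^sub>t Q q) + \<phi> q *\<^sub>t b k q"
      by (simp add: P'q be tscale_simps)
    moreover have "P q - \<phi> q *\<^sub>t Q q \<in> tspan k (\<lambda>i. b i q)"
      by (intro tspan_diff tspan_scale Ps Qs q)
    ultimately show "P' q \<in> tspan (Suc k) (\<lambda>i. b i q)"
      unfolding tspan_Suc by blast
    note Tq = T[OF e q] T[OF XP q] T[OF Q q] T[OF b(1) q]
    have split: "g q (X q - P' q) w = g q (X q - P q) w - \<phi> q * g q (e q) w"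
      if "w \<in> tangent_space M q" for w
    proof -
      have eq: "X q - P' q = (X - P) q - \<phi> q *\<^sub>t e q" by (simp add: P'q algebra_simps)
      show ?thesis
        unfolding eq using that Tq UM[OF q] by (simp add: metric_diff_left metric_scale_left tangent_scale)
    qed
    have o1: "g q (X q - P' q) w = 0" if w: "w \<in> tspan k (\<lambda>i. b i q)" for w
    proof -
      have "w \<in> tangent_space M q"
        using tspan_tangent[OF T[OF b(2) q] w] by blast
      from split[OF this] show ?thesis
        using Po[OF q w] Qo[OF q w] by (simp add: e_def)
    qed
    have o2: "g q (X q - P' q) (e q) = 0"
      using split[OF Tq(1)] e0[OF q] by (simp add: \<phi>_def)
    have TX: "X q - P' q \<in> tangent_space M q"
      using Suc.prems(3) P' q by (simp add: tangent_diff T)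
    show "\<forall>w\<in>tspan (Suc k) (\<lambda>i. b i q). g q (X q - P' q) w = 0"
    proof
      fix w assume "w \<in> tspan (Suc k) (\<lambda>i. b i q)"
      then obtain u c where w: "w = u + c *\<^sub>t b k q" and u: "u \<in> tspan k (\<lambda>i. b i q)"
        by (auto simp: tspan_Suc)
      have "w = (u + c *\<^sub>t Q q) + c *\<^sub>t e q"
        by (simp add: w be tscale_simps)
      moreover have us: "u + c *\<^sub>t Q q \<in> tspan k (\<lambda>i. b i q)"
        by (intro tspan_add tspan_scale u Qs q)
      moreover have "u + c *\<^sub>t Q q \<in> tangent_space M q"
        using tspan_tangent[OF T[OF b(2) q] us] by blast
      ultimately show "g q (X q - P' q) w = 0"
        using o1[OF us] o2 Tq TX UM[OF q]
        by (simp add: metric_add_right metric_scale_right tangent_scale)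
    qed
  qed
  with P' show ?case by blast
qed

end

context smooth_mfd
begin

lemma distribution_frame:
  assumes "distribution M k E" "p \<in> points M"
  obtains U b where "openin (mtop M) U" "p \<in> U" "\<And>i. i < k \<Longrightarrow> b i \<in> vector_fields_on M U"
    "\<And>q. q \<in> U \<Longrightarrow> E q = tspan k (\<lambda>i. b i q)"
    "\<And>q c. q \<in> U \<Longrightarrow> (\<Sum>i<k. c i *\<^sub>t b i q) = 0 \<Longrightarrow> \<forall>i<k. c i = 0"
proof -
  obtain U b where U: "openin (mtop M) U" "p \<in> U" "\<forall>i<k. b i \<in> vector_fields_on M U"
    "\<forall>q\<in>U. is_basis k (\<lambda>i. b i q) (E q)"
    using assms unfolding distribution_def by blast
  show ?thesis
  proof (rule that[OF U(1,2)])
    show "b i \<in> vector_fields_on M U" if "i < k" for i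
      using U(3) that by blast
    show "E q = tspan k (\<lambda>i. b i q)" if "q \<in> U" for q
      using U(4) that by (simp add: is_basis_def tspan_def)
    show "\<forall>i<k. c i = 0" if "q \<in> U" "(\<Sum>i<k. c i *\<^sub>t b i q) = 0" for q c
    proof -
      have "\<forall>c. (\<Sum>i<k. c i *\<^sub>t b i q) = 0 \<longrightarrow> (\<forall>i<k. c i = 0)"
        by (rule conjunct1[OF bspec[OF U(4) that(1), unfolded is_basis_def]])
      from mp[OF spec[OF this] that(2)] show ?thesis .
    qed
  qed
qed

lemma distribution_subspace:
  assumes E: "distribution M k E" and p: "p \<in> points M"
  shows distribution_tangent: "u \<in> E p \<Longrightarrow> u \<in> tangent_space M p"
    and distribution_zero: "0 \<in> E p"
    and distribution_add: "u \<in> E p \<Longrightarrow> v \<in> E p \<Longrightarrow> u + v \<in> E p"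
    and distribution_diff: "u \<in> E p \<Longrightarrow> v \<in> E p \<Longrightarrow> u - v \<in> E p"
proof -
  obtain U b where "openin (mtop M) U" and U: "p \<in> U" "\<And>i. i < k \<Longrightarrow> b i \<in> vector_fields_on M U"
    and span: "\<And>q. q \<in> U \<Longrightarrow> E q = tspan k (\<lambda>i. b i q)"
    and "\<And>q c. q \<in> U \<Longrightarrow> (\<Sum>i<k. c i *\<^sub>t b i q) = 0 \<Longrightarrow> \<forall>i<k. c i = 0"
    by (rule distribution_frame[OF E p]) blast
  have "b i p \<in> tangent_space M p" if "i < k" for i
    using U(2)[OF that] U(1) by (simp add: vector_fields_on_def)
  then show "u \<in> E p \<Longrightarrow> u \<in> tangent_space M p"
    unfolding span[OF U(1)] by (rule tspan_tangent)
  show "0 \<in> E p" "u \<in> E p \<Longrightarrow> v \<in> E p \<Longrightarrow> u + v \<in> E p"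
    "u \<in> E p \<Longrightarrow> v \<in> E p \<Longrightarrow> u - v \<in> E p"
    unfolding span[OF U(1)] by (rule tspan_zero tspan_add tspan_diff; assumption)+
qed

end


section \<open>The tensor of an orthogonal splitting\<close>

locale riemannian_splitting = riemannian_mfd M g
  for M :: "('a, 'e::euclidean_space) manifold" and g +
  fixes E1 E2 :: "'a \<Rightarrow> 'a tvec set" and n1 n2 :: nat
  assumes dist1: "distribution M n1 E1" and dist2: "distribution M n2 E2"
    and orth: "orthogonal_complementary M g E1 E2"
begin

lemmas E1_tangent = distribution_tangent[OF dist1] and E2_tangent = distribution_tangent[OF dist2]
lemmas E1_diff = distribution_diff[OF dist1]

text \<open>All assumptions are symmetric in the two distributions, so every fact about \<open>E1\<close> also holds
  for \<open>E2\<close>.\<close>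

lemma swapped: "riemannian_splitting M g E2 E1 n2 n1"
proof unfold_locales
  show "orthogonal_complementary M g E2 E1"
    unfolding orthogonal_complementary_def
  proof (intro ballI conjI)
    fix p u w assume p: "p \<in> points M" and uw: "u \<in> E2 p" "w \<in> E1 p"
    have "g p w u = 0"
      using orth p uw unfolding orthogonal_complementary_def by blast
    then show "g p u w = 0"
      using metric_sym[OF p E2_tangent[OF p uw(1)] E1_tangent[OF p uw(2)]] by simp
  next
    fix p v assume "p \<in> points M" "v \<in> tangent_space M p"
    then have ex1: "\<exists>!(u, w). u \<in> E1 p \<and> w \<in> E2 p \<and> v = u + w"
      using orth by (simp add: orthogonal_complementary_def)
    then obtain x where x: "case x of (u, w) \<Rightarrow> u \<in> E1 p \<and> w \<in> E2 p \<and> v = u + w"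
      and uniq: "\<And>y. (case y of (u, w) \<Rightarrow> u \<in> E1 p \<and> w \<in> E2 p \<and> v = u + w) \<Longrightarrow> y = x"
      by (rule ex1E) blast
    show "\<exists>!(u, w). u \<in> E2 p \<and> w \<in> E1 p \<and> v = u + w"
    proof (rule ex1I[of _ "(snd x, fst x)"])
      show "case (snd x, fst x) of (u, w) \<Rightarrow> u \<in> E2 p \<and> w \<in> E1 p \<and> v = u + w"
        using x by (simp add: split_beta add.commute)
    next
      fix y assume "case y of (u, w) \<Rightarrow> u \<in> E2 p \<and> w \<in> E1 p \<and> v = u + w"
      then have "(snd y, fst y) = x"
        by (intro uniq) (simp add: split_beta add.commute)
      then show "y = (snd x, fst x)" by (simp add: prod_eq_iff)
    qed
  qed
qed (rule dist2 dist1)+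

text \<open>The projection is characterised by orthogonality of the error, which positive definiteness
  makes unique; it is therefore the component along \<open>E1\<close>.\<close>

lemma orth_proj_eq:
  assumes p: "p \<in> points M" and v: "v \<in> tangent_space M p" and u: "u \<in> E1 p"
    and o: "\<And>w. w \<in> E1 p \<Longrightarrow> g p (v - u) w = 0"
  shows "orth_proj g E1 p v = u"
  unfolding orth_proj_def
proof (rule the_equality)
  show "u \<in> E1 p \<and> (\<forall>w\<in>E1 p. g p (v - u) w = 0)" using u o by blast
next
  fix u' assume u': "u' \<in> E1 p \<and> (\<forall>w\<in>E1 p. g p (v - u') w = 0)"
  have d: "u - u' \<in> E1 p" using E1_diff[OF p u] u' by blast
  have "u - u' = (v - u') - (v - u)" by simp
  then have "g p (u - u') (u - u') = 0"
    using metric_diff_left[OF p, of "v - u'" "v - u" "u - u'"] u' o[OF d] d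
    by (simp add: tangent_diff v u E1_tangent[OF p])
  then have "u - u' = 0"
    using metric_eq_0[OF p] d E1_tangent[OF p] by blast
  then show "u' = u" by simp
qed

lemma orth_proj_sum:
  assumes p: "p \<in> points M" and u: "u \<in> E1 p" and w: "w \<in> E2 p"
  shows "orth_proj g E1 p (u + w) = u"
proof (rule orth_proj_eq[OF p _ u])
  show "u + w \<in> tangent_space M p"
    by (intro tangent_add E1_tangent[OF p u] E2_tangent[OF p w])
  fix x assume x: "x \<in> E1 p"
  have "g p x w = 0"
    using orth p x w unfolding orthogonal_complementary_def by blast
  then show "g p (u + w - u) x = 0"
    using metric_sym[OF p E2_tangent[OF p w] E1_tangent[OF p x]] by simp
qed

lemma orth_components:
  assumes p: "p \<in> points M" and u: "u \<in> E1 p" and w: "w \<in> E2 p"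
  shows "g p u w = 0"
  using orth p u w unfolding orthogonal_complementary_def by blast

lemma orth_components':
  assumes p: "p \<in> points M" and u: "u \<in> E1 p" and w: "w \<in> E2 p"
  shows "g p w u = 0"
  using orth_components[OF assms] metric_sym[OF p E1_tangent[OF p u] E2_tangent[OF p w]] by simp

lemma split_vector:
  assumes p: "p \<in> points M" and v: "v \<in> tangent_space M p"
  obtains u w where "u \<in> E1 p" "w \<in> E2 p" "v = u + w"
proof -
  have "\<exists>!(u, w). u \<in> E1 p \<and> w \<in> E2 p \<and> v = u + w"
    using orth p v by (simp add: orthogonal_complementary_def)
  then obtain x where "case x of (u, w) \<Rightarrow> u \<in> E1 p \<and> w \<in> E2 p \<and> v = u + w"
    by (rule ex1E)
  then show ?thesis using that[of "fst x" "snd x"] by (simp add: split_beta)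
qed

text \<open>Smoothness of the component along \<open>E1\<close> is local, and near a point that component is the
  projection onto a smooth frame; the other component is the difference.\<close>

lemma split_field:
  assumes U: "openin (mtop M) U" and X: "X \<in> vector_fields_on M U"
  obtains X1 X2 where "X1 \<in> vector_fields_on M U" "X2 \<in> vector_fields_on M U" "X = X1 + X2"
    "\<And>p. p \<in> U \<Longrightarrow> X1 p \<in> E1 p" "\<And>p. p \<in> U \<Longrightarrow> X2 p \<in> E2 p"
proof -
  define X1 where "X1 = (\<lambda>p. orth_proj g E1 p (X p))"
  have UM: "p \<in> points M" if "p \<in> U" for p
    using U that openin_subset by blast
  have XT: "X p \<in> tangent_space M p" if "p \<in> U" for p
    using X that by (simp add: vector_fields_on_def)
  have X1: "X1 \<in> vector_fields_on M U"
  proof (rule vector_fields_on_local)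
    fix p assume p: "p \<in> U"
    obtain V b where V: "openin (mtop M) V" "p \<in> V" and b: "\<And>i. i < n1 \<Longrightarrow> b i \<in> vector_fields_on M V"
      and span: "\<And>q. q \<in> V \<Longrightarrow> E1 q = tspan n1 (\<lambda>i. b i q)"
      and indep: "\<And>q c. q \<in> V \<Longrightarrow> (\<Sum>i<n1. c i *\<^sub>t b i q) = 0 \<Longrightarrow> \<forall>i<n1. c i = 0"
      by (rule distribution_frame[OF dist1 UM[OF p]]) blast
    have W: "openin (mtop M) (U \<inter> V)" using U V(1) by (rule openin_Int)
    have "\<exists>P\<in>vector_fields_on M (U \<inter> V). \<forall>q\<in>U \<inter> V. P q \<in> tspan n1 (\<lambda>i. b i q)
      \<and> (\<forall>w\<in>tspan n1 (\<lambda>i. b i q). g q (X q - P q) w = 0)"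
    proof (rule smooth_frame_projection[OF W])
      show "b i \<in> vector_fields_on M (U \<inter> V)" if "i < n1" for i
        using b[OF that] by (rule vector_fields_on_subset) simp
      show "\<forall>i<n1. c i = 0" if "q \<in> U \<inter> V" "(\<Sum>i<n1. c i *\<^sub>t b i q) = 0" for q c
        using that(1) by (intro indep[OF _ that(2)]) simp
      show "X \<in> vector_fields_on M (U \<inter> V)"
        using X by (rule vector_fields_on_subset) simp
    qed
    then obtain P where P: "P \<in> vector_fields_on M (U \<inter> V)"
      and Pp: "\<forall>q\<in>U \<inter> V. P q \<in> tspan n1 (\<lambda>i. b i q)
        \<and> (\<forall>w\<in>tspan n1 (\<lambda>i. b i q). g q (X q - P q) w = 0)" by (rule bexE)
    have "P q = X1 q" if q: "q \<in> U \<inter> V" for q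
    proof -
      have "P q \<in> E1 q" "\<forall>w\<in>E1 q. g q (X q - P q) w = 0"
        using Pp q by (simp_all add: span)
      then show ?thesis
        unfolding X1_def using q by (intro orth_proj_eq[symmetric] UM XT) simp_all
    qed
    then show "\<exists>W Y. openin (mtop M) W \<and> p \<in> W \<and> Y \<in> vector_fields_on M W \<and> (\<forall>q\<in>W. Y q = X1 q)"
      using W p V(2) P by (intro exI[of _ "U \<inter> V"] exI[of _ P]) simp
  qed
  have mem: "X1 p \<in> E1 p \<and> (X - X1) p \<in> E2 p" if p: "p \<in> U" for p
  proof -
    obtain u w where uw: "u \<in> E1 p" "w \<in> E2 p" "X p = u + w"
      by (rule split_vector[OF UM[OF p] XT[OF p]])
    then have "X1 p = u"
      using orth_proj_sum[OF UM[OF p] uw(1,2)] by (simp add: X1_def)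
    then show ?thesis using uw by simp
  qed
  show ?thesis
    by (rule that[OF X1 vector_fields_on_diff[OF U X X1]]) (use mem in simp_all)
qed

text \<open>The 2-tensor of the endomorphism \<open>n\<^sub>2 \<pi>\<^sub>1 - n\<^sub>1 \<pi>\<^sub>2\<close>.\<close>

definition split_tensor :: "'a tensor2" where
  "split_tensor = tensor_of_endo g
    (\<lambda>p v. real n2 *\<^sub>t orth_proj g E1 p v - real n1 *\<^sub>t orth_proj g E2 p v)"

lemma split_tensor_left:
  assumes p: "p \<in> points M" and u: "u \<in> E1 p" and w: "w \<in> E2 p" and v: "v \<in> tangent_space M p"
  shows "split_tensor p (u + w) v = n2 * g p u v - n1 * g p w v"
proof -
  interpret swap: riemannian_splitting M g E2 E1 n2 n1 by (rule swapped)
  have "orth_proj g E2 p (u + w) = w"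
    using swap.orth_proj_sum[OF p w u] by (simp add: add.commute)
  then show ?thesis
    using v by (simp add: split_tensor_def tensor_of_endo_def orth_proj_sum[OF p u w] p
        metric_diff_left metric_scale_left tangent_scale E1_tangent[OF p u] E2_tangent[OF p w])
qed

text \<open>Only the splitting of one of the two arguments has to be known, because the components of the
  other one are orthogonal to those of the opposite distribution.\<close>

lemma split_tensor_right:
  assumes p: "p \<in> points M" and u: "u \<in> E1 p" and w: "w \<in> E2 p" and v: "v \<in> tangent_space M p"
  shows "split_tensor p v (u + w) = n2 * g p v u - n1 * g p v w"
proof -
  obtain u' w' where v': "u' \<in> E1 p" "w' \<in> E2 p" "v = u' + w'"
    by (rule split_vector[OF p v])
  note T = E1_tangent[OF p u] E2_tangent[OF p w] E1_tangent[OF p v'(1)] E2_tangent[OF p v'(2)]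
  have "split_tensor p v (u + w) = n2 * g p u' (u + w) - n1 * g p w' (u + w)"
    unfolding v'(3) by (rule split_tensor_left[OF p v'(1,2) tangent_add[OF T(1,2)]])
  then show ?thesis
    by (simp add: v'(3) metric_add_left metric_add_right p T orth_components[OF p u v'(2)]
        orth_components[OF p v'(1) w] orth_components'[OF p u v'(2)] orth_components'[OF p v'(1) w])
qed

lemma symmetric_split_tensor: "symmetric_2_tensor M split_tensor"
  unfolding symmetric_2_tensor_def
proof (intro conjI ballI allI impI)
  fix p u v assume p: "p \<in> points M" and u: "u \<in> tangent_space M p" and v: "v \<in> tangent_space M p"
  obtain u1 u2 where u': "u1 \<in> E1 p" "u2 \<in> E2 p" "u = u1 + u2"
    by (rule split_vector[OF p u])
  note T = E1_tangent[OF p u'(1)] E2_tangent[OF p u'(2)]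
  show "split_tensor p u v = split_tensor p v u"
    unfolding u'(3) split_tensor_left[OF p u'(1,2) v] split_tensor_right[OF p u'(1,2) v]
    using metric_sym[OF p T(1) v] metric_sym[OF p T(2) v] by simp
next
  fix p u v w
  assume p: "p \<in> points M" and u: "u \<in> tangent_space M p" and v: "v \<in> tangent_space M p"
    and w: "w \<in> tangent_space M p"
  obtain w1 w2 where w': "w1 \<in> E1 p" "w2 \<in> E2 p" "w = w1 + w2"
    by (rule split_vector[OF p w])
  show "split_tensor p (u + v) w = split_tensor p u w + split_tensor p v w"
    unfolding w'(3) split_tensor_right[OF p w'(1,2) u] split_tensor_right[OF p w'(1,2) v]
      split_tensor_right[OF p w'(1,2) tangent_add[OF u v]]
      metric_add_left[OF p u v E1_tangent[OF p w'(1)]] metric_add_left[OF p u v E2_tangent[OF p w'(2)]]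
    by (simp add: algebra_simps)
next
  fix p u v c
  assume p: "p \<in> points M" and u: "u \<in> tangent_space M p" and v: "v \<in> tangent_space M p"
  obtain w1 w2 where w': "w1 \<in> E1 p" "w2 \<in> E2 p" "v = w1 + w2"
    by (rule split_vector[OF p v])
  show "split_tensor p (c *\<^sub>t u) v = c * split_tensor p u v"
    unfolding w'(3) split_tensor_right[OF p w'(1,2) u] split_tensor_right[OF p w'(1,2) tangent_scale[OF u]]
      metric_scale_left[OF p u E1_tangent[OF p w'(1)]] metric_scale_left[OF p u E2_tangent[OF p w'(2)]]
    by (simp add: algebra_simps)
next
  fix U X Y
  assume U: "openin (mtop M) U" and X: "X \<in> vector_fields_on M U" and Y: "Y \<in> vector_fields_on M U"
  obtain X1 X2 where X': "X1 \<in> vector_fields_on M U" "X2 \<in> vector_fields_on M U" "X = X1 + X2"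
    "\<And>p. p \<in> U \<Longrightarrow> X1 p \<in> E1 p" "\<And>p. p \<in> U \<Longrightarrow> X2 p \<in> E2 p"
    by (rule split_field[OF U X]) blast
  have "smooth_function_on M U (\<lambda>p. n2 * g p (X1 p) (Y p) - n1 * g p (X2 p) (Y p))"
    by (intro smooth_function_on_diff smooth_function_on_mult smooth_function_on_const smooth_metric
        U X' Y)
  then show "smooth_function_on M U (\<lambda>p. split_tensor p (X p) (Y p))"
  proof (rule smooth_function_on_cong[OF U])
    fix p assume p: "p \<in> U"
    have "p \<in> points M" using U p openin_subset by blast
    moreover have "Y p \<in> tangent_space M p" using Y p by (simp add: vector_fields_on_def)
    ultimately show "n2 * g p (X1 p) (Y p) - n1 * g p (X2 p) (Y p) = split_tensor p (X p) (Y p)"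
      using split_tensor_left[OF _ X'(4)[OF p] X'(5)[OF p]] by (simp add: X'(3))
  qed
qed

end


section \<open>The covariant derivative of the tensor of a splitting\<close>

locale levi_civita_splitting = riemannian_splitting M g E1 E2 n1 n2
  for M :: "('a, 'e::euclidean_space) manifold" and g E1 E2 n1 n2 +
  fixes nabla :: "'a connection"
  assumes lc: "levi_civita M g nabla"
begin

lemma nabla_field:
  assumes "X \<in> vector_fields M" "Y \<in> vector_fields M"
  shows "nabla X Y \<in> vector_fields M"
  using lc assms unfolding levi_civita_def affine_connection_def by (simp only:)

lemma field_tangent: "X \<in> vector_fields M \<Longrightarrow> p \<in> points M \<Longrightarrow> X p \<in> tangent_space M p"
  by (simp add: vector_fields_on_def)

lemmas nabla_tangent = field_tangent[OF nabla_field]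

lemma nabla_add_left:
  assumes "X \<in> vector_fields M" "Y \<in> vector_fields M" "Z \<in> vector_fields M" "p \<in> points M"
  shows "nabla (X + Y) Z p = nabla X Z p + nabla Y Z p"
  using lc assms unfolding levi_civita_def affine_connection_def by (simp only: plus_fun_apply)

lemma nabla_add_right:
  assumes "X \<in> vector_fields M" "Y \<in> vector_fields M" "Z \<in> vector_fields M" "p \<in> points M"
  shows "nabla X (Y + Z) p = nabla X Y p + nabla X Z p"
  using lc assms unfolding levi_civita_def affine_connection_def by (simp only: plus_fun_apply)

lemma metric_deriv:
  assumes "X \<in> vector_fields M" "Y \<in> vector_fields M" "Z \<in> vector_fields M" "p \<in> points M"
  shows "X p (\<lambda>q. g q (Y q) (Z q)) = g p (nabla X Y p) (Z p) + g p (Y p) (nabla X Z p)"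
  using lc assms unfolding levi_civita_def field_deriv_def by blast

lemma section_field: "X \<in> sections M E \<Longrightarrow> X \<in> vector_fields M"
  and section_mem: "X \<in> sections M E \<Longrightarrow> p \<in> points M \<Longrightarrow> X p \<in> E p"
  by (simp_all add: sections_def)

lemma split_global_field:
  assumes "X \<in> vector_fields M"
  obtains X1 X2 where "X1 \<in> sections M E1" "X2 \<in> sections M E2" "X = X1 + X2"
proof (rule split_field[OF openin_topspace assms])
  fix X1 X2 assume "X1 \<in> vector_fields M" "X2 \<in> vector_fields M" "X = X1 + X2"
    "\<And>p. p \<in> points M \<Longrightarrow> X1 p \<in> E1 p" "\<And>p. p \<in> points M \<Longrightarrow> X2 p \<in> E2 p"
  then show thesis by (intro that[of X1 X2]) (simp_all add: sections_def)
qed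

lemma sections_add1: "X \<in> sections M E1 \<Longrightarrow> Y \<in> sections M E1 \<Longrightarrow> X + Y \<in> sections M E1"
  by (simp add: sections_def vector_fields_on_add distribution_add[OF dist1])

text \<open>The function \<open>g(Y, Z)\<close> vanishes, and so do its derivatives.\<close>

lemma nabla_components:
  assumes X: "X \<in> vector_fields M" and Y: "Y \<in> sections M E1" and Z: "Z \<in> sections M E2"
    and p: "p \<in> points M"
  shows "g p (Y p) (nabla X Z p) = - g p (nabla X Y p) (Z p)"
proof -
  have "X p (\<lambda>q. g q (Y q) (Z q)) = X p (\<lambda>q. 0)"
    by (rule tangent_cong[OF field_tangent[OF X p] p smooth_functions_const, symmetric])
      (simp add: orth_components section_mem[OF Y] section_mem[OF Z])
  also have "\<dots> = 0"
    by (rule tangent_apply_zero[OF field_tangent[OF X p]])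
  finally show ?thesis
    using metric_deriv[OF X section_field[OF Y] section_field[OF Z] p] by simp
qed

text \<open>By metricity the derivatives of \<open>g(Y\<^sub>1, Z\<^sub>1)\<close> and \<open>g(Y\<^sub>2, Z\<^sub>2)\<close> cancel the terms of
  \<open>\<nabla>h\<close> in which no mixing of the distributions occurs. The remaining mixed terms have coefficients
  \<open>n\<^sub>1\<close> and, with the derivative moved to the other factor, \<open>n\<^sub>2\<close>, which add up.\<close>

lemma cov_deriv_split_tensor:
  assumes X: "X \<in> vector_fields M" and Y: "Y1 \<in> sections M E1" "Y2 \<in> sections M E2"
    and Z: "Z1 \<in> sections M E1" "Z2 \<in> sections M E2" and p: "p \<in> points M"
  shows "cov_deriv nabla split_tensor X (Y1 + Y2) (Z1 + Z2) p
    = (n1 + n2) * (g p (nabla X Y1 p) (Z2 p) + g p (nabla X Z1 p) (Y2 p))"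
proof -
  note F = Y[THEN section_field] Z[THEN section_field]
  note Yp = Y[THEN section_mem, OF p] and Zp = Z[THEN section_mem, OF p]
  note T = F[THEN field_tangent, OF p] F[THEN nabla_tangent[OF X], OF p]
  let ?a = "\<lambda>q. g q (Y1 q) (Z1 q)" and ?b = "\<lambda>q. g q (Y2 q) (Z2 q)"
  have sm: "?a \<in> smooth_functions M" "?b \<in> smooth_functions M"
    "(\<lambda>q. n2 * ?a q) \<in> smooth_functions M" "(\<lambda>q. - real n1 * ?b q) \<in> smooth_functions M"
    "(\<lambda>q. n2 * ?a q + - real n1 * ?b q) \<in> smooth_functions M"
    unfolding smooth_functions_def mem_Collect_eq
    by (intro smooth_function_on_add smooth_function_on_mult smooth_function_on_const smooth_metric
        openin_topspace F)+
  have "X p (\<lambda>q. split_tensor q ((Y1 + Y2) q) ((Z1 + Z2) q)) = X p (\<lambda>q. n2 * ?a q + - real n1 * ?b q)"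
  proof (rule tangent_cong[OF field_tangent[OF X p] p sm(5), symmetric])
    fix q assume q: "q \<in> points M"
    note Yq = Y[THEN section_mem, OF q] and Zq = Z[THEN section_mem, OF q]
    note T = F[THEN field_tangent, OF q]
    show "n2 * ?a q + - real n1 * ?b q = split_tensor q ((Y1 + Y2) q) ((Z1 + Z2) q)"
      using split_tensor_left[OF q Yq tangent_add[OF T(3,4)]]
      by (simp add: metric_add_right q T orth_components[OF q Yq(1) Zq(2)] orth_components'[OF q Zq(1) Yq(2)])
  qed
  also have "\<dots> = X p (\<lambda>q. n2 * ?a q) + X p (\<lambda>q. - real n1 * ?b q)"
    by (rule tangent_apply_add[OF field_tangent[OF X p] sm(3,4)])
  also have "\<dots> = n2 * X p ?a - n1 * X p ?b"
    unfolding tangent_apply_scale[OF field_tangent[OF X p] sm(1)]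
      tangent_apply_scale[OF field_tangent[OF X p] sm(2)] by simp
  also have "\<dots> = n2 * (g p (nabla X Y1 p) (Z1 p) + g p (Y1 p) (nabla X Z1 p))
      - n1 * (g p (nabla X Y2 p) (Z2 p) + g p (Y2 p) (nabla X Z2 p))"
    by (simp only: metric_deriv X F p)
  finally have 1: "X p (\<lambda>q. split_tensor q ((Y1 + Y2) q) ((Z1 + Z2) q)) = \<dots>" .
  have nY: "nabla X (Y1 + Y2) p = nabla X Y1 p + nabla X Y2 p"
    and nZ: "nabla X (Z1 + Z2) p = nabla X Z1 p + nabla X Z2 p"
    by (simp_all only: nabla_add_right X F p)
  have 2: "split_tensor p (nabla X (Y1 + Y2) p) ((Z1 + Z2) p)
      = n2 * (g p (nabla X Y1 p) (Z1 p) + g p (nabla X Y2 p) (Z1 p))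
      - n1 * (g p (nabla X Y1 p) (Z2 p) + g p (nabla X Y2 p) (Z2 p))"
    unfolding nY plus_fun_apply[of Z1] split_tensor_right[OF p Zp tangent_add[OF T(5,6)]]
    by (simp only: metric_add_left p T)
  have 3: "split_tensor p ((Y1 + Y2) p) (nabla X (Z1 + Z2) p)
      = n2 * (g p (Y1 p) (nabla X Z1 p) + g p (Y1 p) (nabla X Z2 p))
      - n1 * (g p (Y2 p) (nabla X Z1 p) + g p (Y2 p) (nabla X Z2 p))"
    unfolding nZ plus_fun_apply[of Y1] split_tensor_left[OF p Yp tangent_add[OF T(7,8)]]
    by (simp only: metric_add_right p T)
  have 4: "g p (Y1 p) (nabla X Z2 p) = - g p (nabla X Y1 p) (Z2 p)"
    by (rule nabla_components[OF X Y(1) Z(2) p])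
  have 5: "g p (nabla X Y2 p) (Z1 p) = - g p (nabla X Z1 p) (Y2 p)"
    using nabla_components[OF X Z(1) Y(2) p] metric_sym[OF p T(6) T(3)] by simp
  have 6: "g p (Y2 p) (nabla X Z1 p) = g p (nabla X Z1 p) (Y2 p)"
    by (rule metric_sym[OF p T(2) T(7)])
  show ?thesis
    unfolding cov_deriv_def field_deriv_def 1 2 3 4 5 6 by (simp add: algebra_simps)
qed

lemma zero_section1: "(\<lambda>p. 0) \<in> sections M E1" and zero_section2: "(\<lambda>p. 0) \<in> sections M E2"
  by (simp_all add: sections_def vector_fields_on_zero distribution_zero[OF dist1] distribution_zero[OF dist2])

lemma field_plus_zero: "X + (\<lambda>p. 0) = (X :: 'a vfield)" "(\<lambda>p. 0) + X = (X :: 'a vfield)"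
  by (simp_all add: fun_eq_iff)

lemma cov_deriv_mixed:
  assumes X: "X \<in> vector_fields M" and Y: "Y \<in> sections M E1" and Z: "Z \<in> sections M E2"
    and p: "p \<in> points M"
  shows "cov_deriv nabla split_tensor X Y Z p = (n1 + n2) * g p (nabla X Y p) (Z p)"
    and "cov_deriv nabla split_tensor X Z Y p = (n1 + n2) * g p (nabla X Y p) (Z p)"
  using cov_deriv_split_tensor[OF X Y zero_section2 zero_section1 Z p]
    cov_deriv_split_tensor[OF X zero_section1 Z Y zero_section2 p]
    nabla_tangent[OF X section_field[OF zero_section1] p]
  by (simp_all add: field_plus_zero metric_zero_right[OF p] nabla_tangent[OF X section_field[OF Y] p])

lemma cov_deriv_diag:
  assumes X: "X \<in> vector_fields M" and Y: "Y \<in> sections M E1" and p: "p \<in> points M"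
  shows "cov_deriv nabla split_tensor X Y Y p = 0"
  using cov_deriv_split_tensor[OF X Y zero_section2 Y zero_section2 p]
  by (simp add: field_plus_zero metric_zero_right[OF p nabla_tangent[OF X section_field[OF Y] p]])

text \<open>This covers the case \<open>n1 + n2 = 0\<close>, in which the factor in front of the second fundamental
  forms vanishes and the Killing equation carries no information.\<close>

lemma rank_zero: "n2 = 0 \<Longrightarrow> p \<in> points M \<Longrightarrow> w \<in> E2 p \<Longrightarrow> w = 0"
  by (rule distribution_frame[OF dist2]) (auto simp: tspan_def)

text \<open>The Killing equation is tested against the component in \<open>E2\<close> of \<open>\<nabla>\<^sub>X X\<close> itself. With
  two equal arguments \<open>X\<close>, the four terms of the symmetrization that do not differentiate along
  \<open>W2\<close> agree, and the other two vanish.\<close>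

lemma killing_imp_nabla1:
  assumes kill: "killing_tensor M nabla split_tensor" and X: "X \<in> sections M E1"
  shows "nabla X X \<in> sections M E1"
proof -
  note XF = section_field[OF X]
  have W: "nabla X X \<in> vector_fields M" by (rule nabla_field[OF XF XF])
  obtain W1 W2 where W12: "W1 \<in> sections M E1" "W2 \<in> sections M E2" "nabla X X = W1 + W2"
    by (rule split_global_field[OF W])
  have "W2 p = 0" if p: "p \<in> points M" for p
  proof (cases "n2 = 0")
    case True
    then show ?thesis by (rule rank_zero[OF _ p section_mem[OF W12(2) p]])
  next
    case False
    have W2F: "W2 \<in> vector_fields M" by (rule section_field[OF W12(2)])
    have "symmetrization3 (cov_deriv nabla split_tensor) X X W2 p = 0"
      using kill XF W2F p unfolding killing_tensor_def by blast
    then have "real (n1 + n2) * g p (nabla X X p) (W2 p) = 0"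
      unfolding symmetrization3_def cov_deriv_mixed[OF XF X W12(2) p] cov_deriv_diag[OF W2F X p]
      by simp
    then have "g p (nabla X X p) (W2 p) = 0"
      using False by simp
    then have "g p (W2 p) (W2 p) = 0"
      unfolding W12(3) plus_fun_apply[of W1]
      using metric_add_left[OF p field_tangent[OF section_field[OF W12(1)] p] field_tangent[OF W2F p]
          field_tangent[OF W2F p]]
        orth_components[OF p section_mem[OF W12(1) p] section_mem[OF W12(2) p]] by simp
    then show ?thesis by (rule metric_eq_0[OF p field_tangent[OF W2F p]])
  qed
  then show ?thesis
    using W W12(1,3) by (simp add: sections_def)
qed

text \<open>The tensors are compared only on tangent vectors at points of the manifold; elsewhere their
  values are unspecified and need not be opposite.\<close>

lemma cov_deriv_minus:
  assumes X: "X \<in> vector_fields M" and Y: "Y \<in> vector_fields M" and Z: "Z \<in> vector_fields M"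
    and p: "p \<in> points M"
    and h: "symmetric_2_tensor M h"
    and h': "\<And>q u v. q \<in> points M \<Longrightarrow> u \<in> tangent_space M q \<Longrightarrow> v \<in> tangent_space M q \<Longrightarrow> h' q u v = - h q u v"
  shows "cov_deriv nabla h' X Y Z p = - cov_deriv nabla h X Y Z p"
proof -
  have sm: "(\<lambda>q. h q (Y q) (Z q)) \<in> smooth_functions M"
    using h Y Z by (simp add: symmetric_2_tensor_def smooth_functions_def)
  have "(\<lambda>q. - 1 * h q (Y q) (Z q)) \<in> smooth_functions M"
    using sm unfolding smooth_functions_def mem_Collect_eq
    by (intro smooth_function_on_mult smooth_function_on_const openin_topspace)
  then have "X p (\<lambda>q. h' q (Y q) (Z q)) = X p (\<lambda>q. - 1 * h q (Y q) (Z q))"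
    by (rule tangent_cong[OF field_tangent[OF X p] p, symmetric])
      (simp add: h' field_tangent Y Z)
  also have "\<dots> = - X p (\<lambda>q. h q (Y q) (Z q))"
    using tangent_apply_scale[OF field_tangent[OF X p] sm, of "- 1"] by simp
  finally show ?thesis
    by (simp add: cov_deriv_def field_deriv_def h'[OF p] field_tangent[OF Y p] field_tangent[OF Z p]
        nabla_tangent[OF X Y p] nabla_tangent[OF X Z p])
qed

lemma swapped_lc: "levi_civita_splitting M g E2 E1 n2 n1 nabla"
  by (intro levi_civita_splitting.intro swapped levi_civita_splitting_axioms.intro lc)

lemma killing_swapped:
  assumes "killing_tensor M nabla split_tensor"
  shows "killing_tensor M nabla (riemannian_splitting.split_tensor g E2 E1 n2 n1)"
proof -
  interpret swap: levi_civita_splitting M g E2 E1 n2 n1 nabla by (rule swapped_lc)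
  have neg: "swap.split_tensor q u v = - split_tensor q u v"
    if q: "q \<in> points M" and u: "u \<in> tangent_space M q" and v: "v \<in> tangent_space M q" for q u v
  proof -
    obtain u1 u2 where u': "u1 \<in> E1 q" "u2 \<in> E2 q" "u = u1 + u2"
      by (rule split_vector[OF q u])
    show ?thesis
      using split_tensor_left[OF q u'(1,2) v] swap.split_tensor_left[OF q u'(2,1) v]
      by (simp add: u'(3) add.commute)
  qed
  show ?thesis
    unfolding killing_tensor_def
  proof (intro conjI ballI)
    fix X Y Z p
    assume F: "X \<in> vector_fields M" "Y \<in> vector_fields M" "Z \<in> vector_fields M" and p: "p \<in> points M"
    have "symmetrization3 (cov_deriv nabla split_tensor) X Y Z p = 0"
      using assms F p unfolding killing_tensor_def by blast
    then show "symmetrization3 (cov_deriv nabla swap.split_tensor) X Y Z p = 0"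
      by (simp add: symmetrization3_def cov_deriv_minus[OF _ _ _ p symmetric_split_tensor neg] F)
  qed (rule swap.symmetric_split_tensor)
qed

text \<open>Apply the hypothesis to \<open>X\<close>, \<open>Y\<close> and \<open>X + Y\<close>.\<close>

lemma nabla_polarized:
  assumes geo: "\<forall>X\<in>sections M E1. nabla X X \<in> sections M E1"
    and X: "X \<in> sections M E1" and Y: "Y \<in> sections M E1" and Z: "Z \<in> sections M E2"
    and p: "p \<in> points M"
  shows "g p (nabla X Y p) (Z p) + g p (nabla Y X p) (Z p) = 0"
proof -
  note F = section_field[OF X] section_field[OF Y]
  have XY: "X + Y \<in> vector_fields M" by (rule section_field[OF sections_add1[OF X Y]])
  note T = nabla_tangent[OF F(1) F(1) p] nabla_tangent[OF F(1) F(2) p] nabla_tangent[OF F(2) F(1) p]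
    nabla_tangent[OF F(2) F(2) p] field_tangent[OF section_field[OF Z] p]
  have 0: "g p (nabla V V p) (Z p) = 0" if "V \<in> sections M E1" for V
    using orth_components[OF p section_mem[OF bspec[OF geo that] p] section_mem[OF Z p]] .
  have "nabla (X + Y) (X + Y) p = (nabla X X p + nabla X Y p) + (nabla Y X p + nabla Y Y p)"
    by (simp only: nabla_add_left[OF F XY p] nabla_add_right[OF _ F p] F)
  then have "0 = g p ((nabla X X p + nabla X Y p) + (nabla Y X p + nabla Y Y p)) (Z p)"
    using 0[OF sections_add1[OF X Y]] by simp
  then show ?thesis
    using 0[OF X] 0[OF Y] by (simp only: metric_add_left p T tangent_add)
qed

text \<open>Fact \<open>B\<close> of the proof splits the direction of differentiation and moves the derivative along
  \<open>E2\<close> to the other factor. Then the six terms of the symmetrization become twelve, which cancel in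
  the six pairs \<open>S\<close>: one for each distribution and each pair of the three fields.\<close>

lemma nabla_imp_killing:
  assumes geo1: "\<forall>X\<in>sections M E1. nabla X X \<in> sections M E1"
    and geo2: "\<forall>X\<in>sections M E2. nabla X X \<in> sections M E2"
  shows "killing_tensor M nabla split_tensor"
  unfolding killing_tensor_def
proof (intro conjI ballI)
  interpret swap: levi_civita_splitting M g E2 E1 n2 n1 nabla by (rule swapped_lc)
  fix X Y Z p
  assume F: "X \<in> vector_fields M" "Y \<in> vector_fields M" "Z \<in> vector_fields M" and p: "p \<in> points M"
  obtain X1 X2 where X: "X1 \<in> sections M E1" "X2 \<in> sections M E2" "X = X1 + X2"
    by (rule split_global_field[OF F(1)])
  obtain Y1 Y2 where Y: "Y1 \<in> sections M E1" "Y2 \<in> sections M E2" "Y = Y1 + Y2"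
    by (rule split_global_field[OF F(2)])
  obtain Z1 Z2 where Z: "Z1 \<in> sections M E1" "Z2 \<in> sections M E2" "Z = Z1 + Z2"
    by (rule split_global_field[OF F(3)])
  have B: "g p (nabla (U1 + U2) V1 p) (W2 p) = g p (nabla U1 V1 p) (W2 p) - g p (nabla U2 W2 p) (V1 p)"
    if "U1 \<in> sections M E1" "U2 \<in> sections M E2" "V1 \<in> sections M E1" "W2 \<in> sections M E2"
    for U1 U2 V1 W2
  proof -
    note F = that[THEN section_field]
    note T = nabla_tangent[OF F(1) F(3) p] nabla_tangent[OF F(2) F(3) p] field_tangent[OF F(4) p]
    have "g p (nabla (U1 + U2) V1 p) (W2 p) = g p (nabla U1 V1 p) (W2 p) + g p (nabla U2 V1 p) (W2 p)"
      unfolding nabla_add_left[OF F(1,2,3) p] by (rule metric_add_left[OF p T])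
    moreover have "g p (nabla U2 V1 p) (W2 p) = - g p (nabla U2 W2 p) (V1 p)"
      using nabla_components[OF F(2) that(3,4) p]
        metric_sym[OF p field_tangent[OF F(3) p] nabla_tangent[OF F(2) F(4) p]] by simp
    ultimately show ?thesis by simp
  qed
  note P1 = nabla_polarized[OF geo1 _ _ _ p] and P2 = swap.nabla_polarized[OF geo2 _ _ _ p]
  note S = P1[OF X(1) Y(1) Z(2)] P1[OF X(1) Z(1) Y(2)] P1[OF Y(1) Z(1) X(2)]
    P2[OF X(2) Y(2) Z(1)] P2[OF X(2) Z(2) Y(1)] P2[OF Y(2) Z(2) X(1)]
  have "symmetrization3 (cov_deriv nabla split_tensor) X Y Z p = (n1 + n2) / 3 *
    (g p (nabla X Y1 p) (Z2 p) + g p (nabla X Z1 p) (Y2 p) + g p (nabla Y X1 p) (Z2 p)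
      + g p (nabla Y Z1 p) (X2 p) + g p (nabla Z X1 p) (Y2 p) + g p (nabla Z Y1 p) (X2 p))"
    unfolding symmetrization3_def cov_deriv_split_tensor[OF F(1) Y(1,2) Z(1,2) p, folded Y(3) Z(3)]
      cov_deriv_split_tensor[OF F(1) Z(1,2) Y(1,2) p, folded Y(3) Z(3)]
      cov_deriv_split_tensor[OF F(2) X(1,2) Z(1,2) p, folded X(3) Z(3)]
      cov_deriv_split_tensor[OF F(2) Z(1,2) X(1,2) p, folded X(3) Z(3)]
      cov_deriv_split_tensor[OF F(3) X(1,2) Y(1,2) p, folded X(3) Y(3)]
      cov_deriv_split_tensor[OF F(3) Y(1,2) X(1,2) p, folded X(3) Y(3)]
    by (simp add: field_simps)
  also have "g p (nabla X Y1 p) (Z2 p) + g p (nabla X Z1 p) (Y2 p) + g p (nabla Y X1 p) (Z2 p)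
      + g p (nabla Y Z1 p) (X2 p) + g p (nabla Z X1 p) (Y2 p) + g p (nabla Z Y1 p) (X2 p) = 0"
    unfolding X(3) Y(3) Z(3)
    using S by (simp only: B X(1,2) Y(1,2) Z(1,2))
  finally show "symmetrization3 (cov_deriv nabla split_tensor) X Y Z p = 0" by simp
qed (rule symmetric_split_tensor)

lemma killing_split_tensor_iff:
  "killing_tensor M nabla split_tensor \<longleftrightarrow>
    (\<forall>X\<in>sections M E1. nabla X X \<in> sections M E1) \<and> (\<forall>X\<in>sections M E2. nabla X X \<in> sections M E2)"
proof -
  interpret swap: levi_civita_splitting M g E2 E1 n2 n1 nabla by (rule swapped_lc)
  show ?thesis
    using killing_imp_nabla1 swap.killing_imp_nabla1[OF killing_swapped] nabla_imp_killing by blast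
qed

end

theorem proposition7p2:
  fixes M :: "('a, 'e::euclidean_space) manifold"
    and g :: "'a tensor2"
    and nabla :: "'a connection"
    and E1 E2 :: "'a \<Rightarrow> 'a tvec set"
    and n1 n2 :: nat
    and K :: "'a endo"
  assumes "smooth_manifold M"
    and "connected_space (mtop M)"
    and "riemannian_metric M g"
    and "levi_civita M g nabla"
    and "distribution M n1 E1"
    and "distribution M n2 E2"
    and "orthogonal_complementary M g E1 E2"
    and K_def: "K = (\<lambda>p v. real n2 *\<^sub>t orth_proj g E1 p v - real n1 *\<^sub>t orth_proj g E2 p v)"
  shows "killing_tensor M nabla (tensor_of_endo g K) \<longleftrightarrow>
     (\<forall>X1\<in>sections M E1. nabla X1 X1 \<in> sections M E1) \<and>
     (\<forall>X2\<in>sections M E2. nabla X2 X2 \<in> sections M E2)"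
proof -
  interpret levi_civita_splitting M g E1 E2 n1 n2 nabla
    by unfold_locales (rule assms)+
  show ?thesis
    using killing_split_tensor_iff unfolding split_tensor_def K_def .
qed

end
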